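(* Let $(S,+,\cdot)$ be a (right distributive) seminearring. Then the following statements are equivalent: (1) $S$ is a generalized left completely regular (GLCR) seminearring in which for each $a\in S$ there exists $b\in S$ such that (A1) $aba=a$, (A2) $bab=b$, and (A3) $(a+a^* )b\in\mathcal{H}^+_{ba}$ and $b(a+a^* )\in \mathcal{H}^+_{ba}$, where $a^*$ denotes the unique element of $\mathcal{H}^+_a$ such that $a+a^*+a=a$, $a+a^*=a^*+a$ and $(a+a^* )a=a+a^*$. (2) Every $\mathcal{H}^+$-class of $S$ is a regular near-ring. (3) $S$ is a (disjoint) union of regular near-rings.
   Context: A seminearring $(S,+,\cdot)$ is a set with two operations such that $(S,+)$ and $(S,\cdot)$ are semigroups and multiplication is distributive over addition from the right: $(x+y)z=xz+yz$ for all $x,y,z\in S$. Addition is not assumed commutative. A near-ring is a seminearring $(N,+,\cdot)$ (right distributive) such that $(N,+)$ is a group, not necessarily abelian. A near-ring $N$ is regular if for each $a\in N$ there is $b\in N$ with $aba=a$. $\mathcal{H}^+$ denotes Green's relation $\mathcal{H}$ on the additive semigroup $(S,+)$, and $\mathcal{H}^+_a$ denotes the $\mathcal{H}^+$-class of $a\in S$. A seminearring is additively completely regular if $(S,+)$ is a completely regular semigroup, i.e. for each $a\in S$ there is $x\in S$ with $a+x+a=a$ and $a+x=x+a$; in this case each $(\mathcal{H}^+_a,+)$ is a group. An additively completely regular seminearring $S$ is generalized left completely regular (GLCR) if for each $a\in S$ there exists $x_a\in S$ such that $a+x_a+a=a$, $a+x_a=x_a+a$ and $(a+x_a)a=a+x_a$.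 In a GLCR seminearring, for each $a\in S$ there is a unique element $a^*\in\mathcal{H}^+_a$ with $a+a^*+a=a$, $a+a^*=a^*+a$ and $(a+a^* )a=a+a^*$ (a known fact). "Every $\mathcal{H}^+$-class is a near-ring (of a given type)" means each $\mathcal{H}^+$-class is closed under $+$ and $\cdot$ and is a near-ring (of that type) under the restricted operations. "$S$ is a (disjoint) union of near-rings of a given type" means $S$ is the union of a family of pairwise disjoint subsets, each closed under $+$ and $\cdot$ and each a near-ring of that type under the restricted operations. *)

theory Defs
  imports "HOL-Algebra.Group" "HOL-Library.Disjoint_Sets"
begin

definition semigroup_on :: "'a set \<Rightarrow> ('a \<Rightarrow> 'a \<Rightarrow> 'a) \<Rightarrow> bool" where
  "semigroup_on S f \<longleftrightarrow>
     (\<forall>x\<in>S. \<forall>y\<in>S. f x y \<in> S) \<and>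
     (\<forall>x\<in>S. \<forall>y\<in>S. \<forall>z\<in>S. f (f x y) z = f x (f y z))"

locale seminearring =
  fixes S :: "'a set"
    and add :: "'a \<Rightarrow> 'a \<Rightarrow> 'a" (infixl "\<boxplus>" 65)
    and mul :: "'a \<Rightarrow> 'a \<Rightarrow> 'a" (infixl "\<boxdot>" 70)
  assumes add_semigroup: "semigroup_on S (\<boxplus>)"
    and mul_semigroup: "semigroup_on S (\<boxdot>)"
    and right_distrib: "\<lbrakk>x \<in> S; y \<in> S; z \<in> S\<rbrakk> \<Longrightarrow> (x \<boxplus> y) \<boxdot> z = x \<boxdot> z \<boxplus> y \<boxdot> z"

locale near_ring = seminearring N add mul
  for N :: "'a set"
    and add :: "'a \<Rightarrow> 'a \<Rightarrow> 'a" (infixl "\<boxplus>" 65)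
    and mul :: "'a \<Rightarrow> 'a \<Rightarrow> 'a" (infixl "\<boxdot>" 70) +
  assumes add_group: "\<exists>e. group \<lparr>carrier = N, monoid.mult = (\<boxplus>), one = e\<rparr>"

locale regular_near_ring = near_ring N add mul
  for N :: "'a set"
    and add :: "'a \<Rightarrow> 'a \<Rightarrow> 'a" (infixl "\<boxplus>" 65)
    and mul :: "'a \<Rightarrow> 'a \<Rightarrow> 'a" (infixl "\<boxdot>" 70) +
  assumes regular: "a \<in> N \<Longrightarrow> \<exists>b\<in>N. a \<boxdot> b \<boxdot> a = a"

text \<open>Principal one-sided ideals \<open>S\<^sup>1 a\<close> and \<open>a S\<^sup>1\<close>, without adjoining an identity to \<open>S\<close>.\<close>

definition principal_left_ideal :: "'a set \<Rightarrow> ('a \<Rightarrow> 'a \<Rightarrow> 'a) \<Rightarrow> 'a \<Rightarrow> 'a set" where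
  "principal_left_ideal S f a = insert a ((\<lambda>s. f s a) ` S)"

definition principal_right_ideal :: "'a set \<Rightarrow> ('a \<Rightarrow> 'a \<Rightarrow> 'a) \<Rightarrow> 'a \<Rightarrow> 'a set" where
  "principal_right_ideal S f a = insert a ((\<lambda>s. f a s) ` S)"

definition green_L :: "'a set \<Rightarrow> ('a \<Rightarrow> 'a \<Rightarrow> 'a) \<Rightarrow> 'a rel" where
  "green_L S f = {(a, b) \<in> S \<times> S. principal_left_ideal S f a = principal_left_ideal S f b}"

definition green_R :: "'a set \<Rightarrow> ('a \<Rightarrow> 'a \<Rightarrow> 'a) \<Rightarrow> 'a rel" where
  "green_R S f = {(a, b) \<in> S \<times> S. principal_right_ideal S f a = principal_right_ideal S f b}"

definition green_H :: "'a set \<Rightarrow> ('a \<Rightarrow> 'a \<Rightarrow> 'a) \<Rightarrow> 'a rel" where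
  "green_H S f = green_L S f \<inter> green_R S f"

lemma equiv_green_H: "equiv S (green_H S f)"
  by (rule equivI) (auto simp: green_H_def green_L_def green_R_def refl_on_def sym_def trans_def)

context seminearring
begin

definition Hp_class :: "'a \<Rightarrow> 'a set" where
  "Hp_class a = green_H S (\<boxplus>) `` {a}"

definition additively_completely_regular :: bool where
  "additively_completely_regular \<longleftrightarrow>
     (\<forall>a\<in>S. \<exists>x\<in>S. a \<boxplus> x \<boxplus> a = a \<and> a \<boxplus> x = x \<boxplus> a)"

definition GLCR :: bool where
  "GLCR \<longleftrightarrow> additively_completely_regular \<and>
     (\<forall>a\<in>S. \<exists>x\<in>S. a \<boxplus> x \<boxplus> a = a \<and> a \<boxplus> x = x \<boxplus> a \<and> (a \<boxplus> x) \<boxdot> a = a \<boxplus> x)"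

text \<open>Meaningful only when \<open>GLCR\<close> holds, see \<open>star_ex1\<close> below.\<close>

definition star :: "'a \<Rightarrow> 'a" where
  "star a = (THE y. y \<in> Hp_class a \<and>
     a \<boxplus> y \<boxplus> a = a \<and> a \<boxplus> y = y \<boxplus> a \<and> (a \<boxplus> y) \<boxdot> a = a \<boxplus> y)"

lemma star_ex1:
  assumes "GLCR" and a: "a \<in> S"
  shows "\<exists>!y. y \<in> Hp_class a \<and>
     a \<boxplus> y \<boxplus> a = a \<and> a \<boxplus> y = y \<boxplus> a \<and> (a \<boxplus> y) \<boxdot> a = a \<boxplus> y"
proof -
  have cl: "x \<boxplus> y \<in> S" if "x \<in> S" "y \<in> S" for x y
    using add_semigroup that by (auto simp: semigroup_on_def)
  have as: "x \<boxplus> y \<boxplus> z = x \<boxplus> (y \<boxplus> z)" if "x \<in> S" "y \<in> S" "z \<in> S" for x y z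
    using add_semigroup that by (auto simp: semigroup_on_def)
  have left_sub: "principal_left_ideal S (\<boxplus>) u \<subseteq> principal_left_ideal S (\<boxplus>) v"
    if "s \<in> S" "v \<in> S" "u = s \<boxplus> v" for s u v
    using that by (force simp: principal_left_ideal_def image_iff cl as[symmetric])
  have right_sub: "principal_right_ideal S (\<boxplus>) u \<subseteq> principal_right_ideal S (\<boxplus>) v"
    if "s \<in> S" "v \<in> S" "u = v \<boxplus> s" for s u v
    using that by (force simp: principal_right_ideal_def image_iff cl as)
  obtain x where x: "x \<in> S" "a \<boxplus> x \<boxplus> a = a" "a \<boxplus> x = x \<boxplus> a" "(a \<boxplus> x) \<boxdot> a = a \<boxplus> x"
    using assms by (auto simp: GLCR_def)
  define y where "y = x \<boxplus> a \<boxplus> x"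
  have y: "y \<in> S" using x a by (simp add: y_def cl)
  have ay: "a \<boxplus> y = a \<boxplus> x"
    by (metis a as cl x(1,2) y_def)
  have ya: "y \<boxplus> a = x \<boxplus> a"
    by (metis a as cl x(1,2) y_def)
  have 1: "y = (x \<boxplus> x) \<boxplus> a" by (metis a as x(1,3) y_def)
  have 2: "y = a \<boxplus> (x \<boxplus> x)" by (metis a as x(1,3) y_def)
  have 3: "a = (a \<boxplus> a) \<boxplus> y" by (metis a as ay x y)
  have 4: "a = y \<boxplus> (a \<boxplus> a)" by (metis a as ya x y)
  have "principal_left_ideal S (\<boxplus>) a = principal_left_ideal S (\<boxplus>) y"
    using left_sub[OF _ _ 1] left_sub[OF _ _ 3] a x y cl by blast
  moreover have "principal_right_ideal S (\<boxplus>) a = principal_right_ideal S (\<boxplus>) y"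
    using right_sub[OF _ _ 2] right_sub[OF _ _ 4] a x y cl by blast
  ultimately have yH: "y \<in> Hp_class a"
    using a y by (auto simp: Hp_class_def green_H_def green_L_def green_R_def)
  have mem: "z \<in> S \<and> (z = a \<or> (\<exists>s\<in>S. z = s \<boxplus> a)) \<and> (z = a \<or> (\<exists>s\<in>S. z = a \<boxplus> s))"
    if "z \<in> Hp_class a" for z
    using that
    by (auto simp: Hp_class_def green_H_def green_L_def green_R_def
        principal_left_ideal_def principal_right_ideal_def)
  have uniq: "z = w" if z: "z \<in> Hp_class a" "a \<boxplus> z \<boxplus> a = a" "a \<boxplus> z = z \<boxplus> a"
    and w: "w \<in> Hp_class a" "a \<boxplus> w \<boxplus> a = a" "a \<boxplus> w = w \<boxplus> a" for z w
  proof -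
    have zS: "z \<in> S" and wS: "w \<in> S" using mem z w by auto
    have e: "a \<boxplus> z = a \<boxplus> w"
      by (metis a as cl w(2,3) wS z(2,3) zS)
    have "z = z \<boxplus> (a \<boxplus> z)"
      using mem[OF z(1)] by (metis a as cl z(2,3) zS)
    moreover have "w = (a \<boxplus> w) \<boxplus> w"
      using mem[OF w(1)] by (metis a as cl w(2,3) wS)
    ultimately show ?thesis by (metis a as e wS z(3) zS)
  qed
  show ?thesis
    using uniq yH ay ya x by (intro ex1I[of _ y]) auto
qed

end

end

theory Submission
  imports Defs
begin

text \<open>Right multiplications are endomorphisms of \<open>(S,+)\<close>, so \<open>\<H>\<^sup>+\<close> is a right congruence of
  \<open>(S,\<cdot>)\<close>. Write \<open>e = a + a\<^sup>*\<close> for the zero of the additive group \<open>\<H>\<^sup>+\<^sub>a\<close>.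
  If \<open>x, y\<close> lie in \<open>\<H>\<^sup>+\<^sub>a\<close>, then \<open>xy \<H>\<^sup>+ ey = e\<close>, so the classes of a GLCR seminearring are closed
  under multiplication and are near-rings. Given \<open>b\<close> as in (A1)--(A3), we have
  \<open>ab \<H>\<^sup>+ eb \<H>\<^sup>+ ba\<close> and hence \<open>a = aba \<H>\<^sup>+ baa \<H>\<^sup>+ bea = be \<H>\<^sup>+ ba\<close>; multiplying by \<open>b\<close>
  from the right gives \<open>ab \<H>\<^sup>+ bab = b\<close>, so \<open>b\<close> lies in \<open>\<H>\<^sup>+\<^sub>a\<close>.
  In a disjoint union of near-rings every summand lies in a single \<open>\<H>\<^sup>+\<close>-class, and it fills that
  class because an \<open>\<H>\<close>-class contains at most one idempotent.\<close>

section \<open>Green's relation \<open>\<H>\<close>\<close>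

lemma semigroup_on_closed: "\<lbrakk>semigroup_on S f; x \<in> S; y \<in> S\<rbrakk> \<Longrightarrow> f x y \<in> S"
  by (simp add: semigroup_on_def)

lemma semigroup_on_assoc:
  "\<lbrakk>semigroup_on S f; x \<in> S; y \<in> S; z \<in> S\<rbrakk> \<Longrightarrow> f (f x y) z = f x (f y z)"
  by (simp add: semigroup_on_def)

text \<open>Each generator lies in the other's ideal, either as the generator itself or as a
  multiple. The disjunct \<open>a = b\<close> stands for the adjoined identity and leaves only
  multipliers from \<open>S\<close> to handle.\<close>

lemma principal_left_ideal_eq_iff:
  assumes "semigroup_on S f" "a \<in> S" "b \<in> S"
  shows "principal_left_ideal S f a = principal_left_ideal S f b \<longleftrightarrow>
    a = b \<or> (\<exists>s\<in>S. \<exists>t\<in>S. a = f s b \<and> b = f t a)" (is "?L \<longleftrightarrow> ?R")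
proof
  assume ?L
  then have "a \<in> principal_left_ideal S f b" "b \<in> principal_left_ideal S f a"
    by (auto simp: principal_left_ideal_def)
  then show ?R by (auto simp: principal_left_ideal_def)
next
  have sub: "principal_left_ideal S f (f s b) \<subseteq> principal_left_ideal S f b"
    if "s \<in> S" "b \<in> S" for s b
    using that assms(1)
    by (auto simp: principal_left_ideal_def semigroup_on_closed semigroup_on_assoc[symmetric])
  assume ?R
  then show ?L using sub assms by (metis subset_antisym)
qed

lemma principal_right_ideal_eq_iff:
  assumes "semigroup_on S f" "a \<in> S" "b \<in> S"
  shows "principal_right_ideal S f a = principal_right_ideal S f b \<longleftrightarrow>
    a = b \<or> (\<exists>s\<in>S. \<exists>t\<in>S. a = f b s \<and> b = f a t)" (is "?L \<longleftrightarrow> ?R")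
proof
  assume ?L
  then have "a \<in> principal_right_ideal S f b" "b \<in> principal_right_ideal S f a"
    by (auto simp: principal_right_ideal_def)
  then show ?R by (auto simp: principal_right_ideal_def)
next
  have sub: "principal_right_ideal S f (f b s) \<subseteq> principal_right_ideal S f b"
    if "s \<in> S" "b \<in> S" for s b
    using that assms(1)
    by (auto simp: principal_right_ideal_def semigroup_on_closed semigroup_on_assoc)
  assume ?R
  then show ?L using sub assms by (metis subset_antisym)
qed

lemma green_H_iff:
  assumes "semigroup_on S f"
  shows "(a, b) \<in> green_H S f \<longleftrightarrow> a \<in> S \<and> b \<in> S \<and>
    (a = b \<or> (\<exists>s\<in>S. \<exists>t\<in>S. a = f s b \<and> b = f t a) \<and> (\<exists>s\<in>S. \<exists>t\<in>S. a = f b s \<and> b = f a t))"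
proof (cases "a \<in> S \<and> b \<in> S")
  case True
  then show ?thesis
    using principal_left_ideal_eq_iff[OF assms, of a b] principal_right_ideal_eq_iff[OF assms, of a b]
    unfolding green_H_def green_L_def green_R_def by blast
qed (auto simp: green_H_def green_L_def)

lemma green_H_sym: "(a, b) \<in> green_H S f \<Longrightarrow> (b, a) \<in> green_H S f"
  using equiv_green_H by (meson equivE symD)

lemma green_H_trans: "\<lbrakk>(a, b) \<in> green_H S f; (b, c) \<in> green_H S f\<rbrakk> \<Longrightarrow> (a, c) \<in> green_H S f"
  using equiv_green_H by (meson equivE transD)

section \<open>Classes of idempotents as maximal subgroups\<close>

lemma green_H_idempotent_iff:
  assumes sg: "semigroup_on S f" and e: "e \<in> S" "f e e = e"
  shows "(e, x) \<in> green_H S f \<longleftrightarrow>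
    x \<in> S \<and> f e x = x \<and> f x e = x \<and> (\<exists>s\<in>S. f s x = e) \<and> (\<exists>t\<in>S. f x t = e)" (is "?L \<longleftrightarrow> ?R")
proof
  assume ?L
  then consider "x = e" | "x \<in> S" "\<exists>s\<in>S. \<exists>t\<in>S. e = f s x \<and> x = f t e"
    "\<exists>s\<in>S. \<exists>t\<in>S. e = f x s \<and> x = f e t"
    using green_H_iff[OF sg] by metis
  then show ?R
  proof cases
    case 1
    then show ?thesis using e by auto
  next
    case 2
    \<comment> \<open>From \<open>x = f t e\<close> and \<open>x = f e t\<close> with
      \<open>e\<close> idempotent, \<open>e\<close> fixes \<open>x\<close> on both sides.\<close>
    then show ?thesis using e semigroup_on_assoc[OF sg] by metis
  qed
next
  assume ?R
  \<comment> \<open>The multiplier taking \<open>e\<close> to \<open>x\<close> is \<open>x\<close>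
    itself, on either side.\<close>
  then show ?L unfolding green_H_iff[OF sg] using e by metis
qed

text \<open>Each of the two idempotents acts as an identity on the other, so both equal their
  product.\<close>

lemma green_H_idempotent_unique:
  assumes "semigroup_on S f" "(e, e') \<in> green_H S f" "f e e = e" "f e' e' = e'"
  shows "e = e'"
  using assms green_H_idempotent_iff[of S f e e'] green_H_idempotent_iff[of S f e' e]
    green_H_sym[of e e' S f] green_H_iff[of S f e e'] by metis

text \<open>Green's theorem for the class of an idempotent. The multipliers that lead from an
  element back to \<open>e\<close> become its inverse.\<close>

lemma group_green_H_class:
  assumes sg: "semigroup_on S f" and e: "e \<in> S" "f e e = e"
  shows "group \<lparr>carrier = green_H S f `` {e}, monoid.mult = f, one = e\<rparr>"
proof -
  note cl = semigroup_on_closed[OF sg] and as = semigroup_on_assoc[OF sg]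
  note iff = green_H_idempotent_iff[OF sg e]
  have inv: "\<exists>y. (e, y) \<in> green_H S f \<and> f y x = e" if x: "(e, x) \<in> green_H S f" for x
  proof -
    obtain s t where st: "s \<in> S" "t \<in> S" "f s x = e" "f x t = e" and xS: "x \<in> S"
      and ex: "f e x = x" "f x e = x" using x iff by auto
    \<comment> \<open>The multipliers \<open>s\<close> and \<open>t\<close> need not lie in the
      class; multiplying by \<open>e\<close> on both sides brings them into \<open>eSe\<close>,
      where a left and a right inverse of \<open>x\<close> coincide.\<close>
    define l where "l = f e (f s e)"
    define r where "r = f e (f t e)"
    have S: "l \<in> S" "r \<in> S" using st e by (auto simp: l_def r_def cl)
    have lx: "f l x = e" using st e xS ex by (simp add: l_def as cl)
    have xr: "f x r = e"
      unfolding r_def by (metis as cl e st(2,4) xS ex(2))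
    have le: "f l e = l" "f e r = r" using st e by (auto simp: l_def r_def as cl)
      (metis as cl e st(2))
    have "l = r" using le lx xr S xS by (metis as)
    moreover have "f e l = l" using \<open>l = r\<close> le by simp
    ultimately have "(e, l) \<in> green_H S f"
      unfolding iff using S le lx xr xS by auto
    then show ?thesis using lx by blast
  qed
  have prod: "(e, f x y) \<in> green_H S f"
    if x: "(e, x) \<in> green_H S f" and y: "(e, y) \<in> green_H S f" for x y
  proof -
    obtain s t where st: "s \<in> S" "t \<in> S" "f s x = e" "f x t = e" and xS: "x \<in> S"
      and ex: "f e x = x" "f x e = x" using x iff by auto
    obtain s' t' where st': "s' \<in> S" "t' \<in> S" "f s' y = e" "f y t' = e" and yS: "y \<in> S"
      and ey: "f e y = y" "f y e = y" using y iff by auto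
    have "f (f s' s) (f x y) = e" by (metis as cl ey(1) st st' xS yS)
    moreover have "f (f x y) (f t' t) = e" by (metis as cl ex(2) st st' xS yS)
    moreover have "f e (f x y) = f x y" "f (f x y) e = f x y"
      using as ex ey e xS yS by metis+
    ultimately show ?thesis unfolding iff using cl st st' xS yS by metis
  qed
  show ?thesis
  proof (rule groupI, goal_cases)
    case 2
    show ?case using iff e by auto
  next
    case (3 x y z)
    then show ?case using as iff by auto
  next
    case (4 x)
    then show ?case using iff by auto
  next
    case (5 x)
    then show ?case using inv by auto
  qed (use prod in auto)
qed

text \<open>Group laws in terms of bare \<open>N\<close>, \<open>f\<close> and \<open>e\<close>, so
  that several subgroups can be handled in one proof without interpretations.\<close>

lemma group_recordD:
  assumes "group \<lparr>carrier = N, monoid.mult = f, one = e\<rparr>"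
  shows "e \<in> N" and "x \<in> N \<Longrightarrow> f e x = x" and "x \<in> N \<Longrightarrow> f x e = x"
    and "x \<in> N \<Longrightarrow> \<exists>y\<in>N. f x y = e \<and> f y x = e"
    and "\<lbrakk>x \<in> N; f x x = x\<rbrakk> \<Longrightarrow> x = e"
proof -
  interpret group "\<lparr>carrier = N, monoid.mult = f, one = e\<rparr>" by (rule assms)
  show "e \<in> N" and "x \<in> N \<Longrightarrow> f e x = x" and "x \<in> N \<Longrightarrow> f x e = x"
    using one_closed l_one[of x] r_one[of x] by simp_all
  show "x \<in> N \<Longrightarrow> \<exists>y\<in>N. f x y = e \<and> f y x = e"
    using inv_closed[of x] r_inv[of x] l_inv[of x] by auto
  show "\<lbrakk>x \<in> N; f x x = x\<rbrakk> \<Longrightarrow> x = e"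
    using r_cancel_one[of x x] by simp
qed

text \<open>Inverses taken in \<open>N\<close> supply the multipliers that lead from
  \<open>x\<close> back to \<open>e\<close>.\<close>

lemma subgroup_green_H:
  assumes sg: "semigroup_on S f" and "N \<subseteq> S"
    and grp: "group \<lparr>carrier = N, monoid.mult = f, one = e\<rparr>" and x: "x \<in> N"
  shows "(e, x) \<in> green_H S f"
proof -
  note G = group_recordD[OF grp]
  have "e \<in> S" "f e e = e" using G(1,2) assms(2) by auto
  from green_H_idempotent_iff[OF sg this] show ?thesis
    using G(2-4)[OF x] x assms(2) by blast
qed

section \<open>Near-rings inside a seminearring\<close>

context near_ring
begin

text \<open>Right multiplication by \<open>a\<close> is additive, so it sends \<open>e\<close> to an
  additive idempotent of \<open>N\<close>, and a group has only one.\<close>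

lemma zero_mul:
  assumes "group \<lparr>carrier = N, monoid.mult = (\<boxplus>), one = e\<rparr>" "a \<in> N"
  shows "e \<boxdot> a = e"
proof -
  note G = group_recordD[OF assms(1)]
  have "e \<boxdot> a \<boxplus> e \<boxdot> a = e \<boxdot> a" using right_distrib[of e e a] G(1,2) assms(2) by simp
  then show ?thesis using G(1,5) assms(2) semigroup_on_closed[OF mul_semigroup] by blast
qed

end

context regular_near_ring
begin

text \<open>If \<open>c\<close> satisfies the regularity equation for \<open>a\<close>, then the
  product \<open>cac\<close> also satisfies the second equation, which (A2) asks for.\<close>

lemma reflexive_inverse:
  assumes a: "a \<in> N"
  shows "\<exists>b\<in>N. a \<boxdot> b \<boxdot> a = a \<and> b \<boxdot> a \<boxdot> b = b"
proof -
  note cl = semigroup_on_closed[OF mul_semigroup] and as = semigroup_on_assoc[OF mul_semigroup]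
  obtain c where c: "c \<in> N" "a \<boxdot> c \<boxdot> a = a" using regular a by blast
  then have c': "a \<boxdot> (c \<boxdot> a) = a" using a by (simp add: as)
  have "a \<boxdot> (c \<boxdot> a \<boxdot> c) \<boxdot> a = a" using a c' c(1) by (simp add: as cl)
  moreover have "c \<boxdot> a \<boxdot> c \<boxdot> a \<boxdot> (c \<boxdot> a \<boxdot> c) = c \<boxdot> a \<boxdot> c"
    using a c c' by (metis as cl)
  ultimately show ?thesis using a c(1) cl by blast
qed

end

section \<open>Additive H-classes and right multiplication\<close>

context seminearring
begin

lemmas add_closed = semigroup_on_closed[OF add_semigroup]
lemmas mul_closed = semigroup_on_closed[OF mul_semigroup]
lemmas mul_assoc = semigroup_on_assoc[OF mul_semigroup]

lemma Hp_class_iff: "x \<in> Hp_class a \<longleftrightarrow> (a, x) \<in> green_H S (\<boxplus>)"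
  by (simp add: Hp_class_def)

lemma Hp_class_eq: "(a, b) \<in> green_H S (\<boxplus>) \<Longrightarrow> Hp_class a = Hp_class b"
  unfolding Hp_class_def using equiv_class_eq[OF equiv_green_H] .

lemma Hp_class_subset: "Hp_class a \<subseteq> S"
  using green_H_iff[OF add_semigroup] by (auto simp: Hp_class_iff)

lemma Hp_class_self: "a \<in> S \<Longrightarrow> a \<in> Hp_class a"
  using green_H_iff[OF add_semigroup] by (auto simp: Hp_class_iff)

lemma quotient_green_H: "S // green_H S (\<boxplus>) = Hp_class ` S"
  by (auto simp: quotient_def Hp_class_def)

text \<open>Right distributivity carries the additive multipliers \<open>s\<close>, \<open>t\<close>
  to \<open>s \<boxdot> z\<close>, \<open>t \<boxdot> z\<close>. It gives no such control of left
  multiplication, which is what the second half of (A3) provides for \<open>b\<close>.\<close>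

lemma green_H_mul_right:
  assumes "(x, y) \<in> green_H S (\<boxplus>)" "z \<in> S"
  shows "(x \<boxdot> z, y \<boxdot> z) \<in> green_H S (\<boxplus>)"
proof -
  note H = assms(1)[unfolded green_H_iff[OF add_semigroup]]
  have S: "x \<in> S" "y \<in> S" using H by blast+
  have "(\<exists>s\<in>S. \<exists>t\<in>S. x \<boxdot> z = s \<boxplus> y \<boxdot> z \<and> y \<boxdot> z = t \<boxplus> x \<boxdot> z) \<and>
    (\<exists>s\<in>S. \<exists>t\<in>S. x \<boxdot> z = y \<boxdot> z \<boxplus> s \<and> y \<boxdot> z = x \<boxdot> z \<boxplus> t)" if ne: "x \<noteq> y"
  proof -
    obtain s t s' t' where st: "s \<in> S" "t \<in> S" "s' \<in> S" "t' \<in> S"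
      and eq: "s \<boxplus> y = x" "t \<boxplus> x = y" "y \<boxplus> s' = x" "x \<boxplus> t' = y"
      using H ne by metis
    have "x \<boxdot> z = s \<boxdot> z \<boxplus> y \<boxdot> z" "y \<boxdot> z = t \<boxdot> z \<boxplus> x \<boxdot> z"
      "x \<boxdot> z = y \<boxdot> z \<boxplus> s' \<boxdot> z" "y \<boxdot> z = x \<boxdot> z \<boxplus> t' \<boxdot> z"
      using st S assms(2) by (simp_all add: eq flip: right_distrib)
    then show ?thesis using st assms(2) mul_closed by blast
  qed
  then show ?thesis unfolding green_H_iff[OF add_semigroup] using S assms(2) mul_closed by blast
qed

lemma near_ring_subset:
  assumes "N \<subseteq> S" and grp: "group \<lparr>carrier = N, monoid.mult = (\<boxplus>), one = e\<rparr>"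
    and "\<And>x y. \<lbrakk>x \<in> N; y \<in> N\<rbrakk> \<Longrightarrow> x \<boxdot> y \<in> N"
  shows "near_ring N (\<boxplus>) (\<boxdot>)"
proof unfold_locales
  interpret group "\<lparr>carrier = N, monoid.mult = (\<boxplus>), one = e\<rparr>" by (rule grp)
  show "semigroup_on N (\<boxplus>)"
    using m_closed m_assoc by (simp add: semigroup_on_def)
  show "semigroup_on N (\<boxdot>)"
    using assms(1,3) by (auto simp: semigroup_on_def mul_assoc subset_iff)
  show "(x \<boxplus> y) \<boxdot> z = x \<boxdot> z \<boxplus> y \<boxdot> z" if "x \<in> N" "y \<in> N" "z \<in> N" for x y z
    using right_distrib that assms(1) by auto
  show "\<exists>e. group \<lparr>carrier = N, monoid.mult = (\<boxplus>), one = e\<rparr>" using grp by blast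
qed

section \<open>Multiplication in GLCR seminearrings\<close>

lemma GLCR_zero:
  assumes "GLCR" "a \<in> S" and e: "e = a \<boxplus> star a"
  shows "e \<in> S" "e \<boxplus> e = e" "(a, e) \<in> green_H S (\<boxplus>)" "e \<boxdot> a = e"
proof -
  \<comment> \<open>\<open>star\<close> is a definite description; \<open>star_ex1\<close> makes its
    defining equations available.\<close>
  have st: "star a \<in> Hp_class a \<and> a \<boxplus> star a \<boxplus> a = a \<and> a \<boxplus> star a = star a \<boxplus> a \<and>
      (a \<boxplus> star a) \<boxdot> a = a \<boxplus> star a"
    unfolding star_def by (rule theI'[OF star_ex1[OF assms(1,2)]])
  then have s: "star a \<in> S" using Hp_class_subset by blast
  note as = semigroup_on_assoc[OF add_semigroup]
  show eS: "e \<in> S" using e s assms(2) add_closed by blast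
  show "e \<boxdot> a = e" using st e by blast
  show ee: "e \<boxplus> e = e" unfolding e by (metis as assms(2) s st add_closed)
  have "e \<boxplus> a = a" "a \<boxplus> e = a" "star a \<boxplus> a = e" "a \<boxplus> star a = e"
    using st e s assms(2) as by metis+
  then have "(e, a) \<in> green_H S (\<boxplus>)"
    using green_H_idempotent_iff[OF add_semigroup eS ee] s assms(2) by blast
  then show "(a, e) \<in> green_H S (\<boxplus>)" by (rule green_H_sym)
qed

lemma GLCR_Hp_class_near_ring:
  assumes "GLCR" "a \<in> S"
  shows "near_ring (Hp_class a) (\<boxplus>) (\<boxdot>)"
proof -
  define e where "e = a \<boxplus> star a"
  note Z = GLCR_zero[OF assms e_def]
  have C: "Hp_class a = green_H S (\<boxplus>) `` {e}"
    using Hp_class_eq[OF Z(3)] by (simp add: Hp_class_def)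
  have "x \<boxdot> y \<in> Hp_class a" if x: "x \<in> Hp_class a" and y: "y \<in> Hp_class a" for x y
  proof -
    have yS: "y \<in> S" using y Hp_class_subset by blast
    note Y = GLCR_zero[OF assms(1) yS refl]
    \<comment> \<open>GLCR controls only the product of \<open>y\<close> with its own zero
      \<open>y \<boxplus> star y\<close>. Since \<open>y\<close> lies in the class of
      \<open>a\<close>, that zero is an idempotent of the same class and hence equals
      \<open>e\<close>.\<close>
    have "(e, y \<boxplus> star y) \<in> green_H S (\<boxplus>)"
      using Z(3) y Y(3) green_H_sym green_H_trans unfolding Hp_class_iff by metis
    then have "y \<boxplus> star y = e"
      using green_H_idempotent_unique[OF add_semigroup] Z(2) Y(2) by metis
    then have ey: "e \<boxdot> y = e" using Y(4) by simp
    have "(e, x) \<in> green_H S (\<boxplus>)"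
      using Z(3) x green_H_sym green_H_trans unfolding Hp_class_iff by metis
    from green_H_mul_right[OF this yS] show ?thesis
      unfolding ey Hp_class_iff using Z(3) green_H_trans by metis
  qed
  then show ?thesis
    by (rule near_ring_subset[OF Hp_class_subset
        group_green_H_class[OF add_semigroup Z(1,2), folded C]])
qed

text \<open>Here (A3) enters: an inverse found somewhere in \<open>S\<close> is forced into the
  class of \<open>a\<close>, which makes the class itself regular.\<close>

lemma GLCR_inverse_in_Hp_class:
  assumes glcr: "GLCR" and a: "a \<in> S" and b: "b \<in> S"
    and aba: "a \<boxdot> b \<boxdot> a = a" and bab: "b \<boxdot> a \<boxdot> b = b"
    and eb: "(a \<boxplus> star a) \<boxdot> b \<in> Hp_class (b \<boxdot> a)"
    and be: "b \<boxdot> (a \<boxplus> star a) \<in> Hp_class (b \<boxdot> a)"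
  shows "b \<in> Hp_class a"
proof -
  define e where "e = a \<boxplus> star a"
  note Z = GLCR_zero[OF glcr a e_def]
  have be': "(b \<boxdot> a, b \<boxdot> e) \<in> green_H S (\<boxplus>)" and eb': "(b \<boxdot> a, e \<boxdot> b) \<in> green_H S (\<boxplus>)"
    using be eb by (simp_all add: Hp_class_iff e_def)
  have ab: "(a \<boxdot> b, b \<boxdot> a) \<in> green_H S (\<boxplus>)"
    using green_H_mul_right[OF Z(3) b] eb' green_H_sym green_H_trans by metis
  have "(a, b \<boxdot> a \<boxdot> a) \<in> green_H S (\<boxplus>)" using green_H_mul_right[OF ab a] aba by simp
  \<comment> \<open>Multiplying \<open>be'\<close> by \<open>a\<close> from the right leaves
    \<open>b \<boxdot> e\<close> unchanged, because \<open>e \<boxdot> a = e\<close>.\<close>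
  moreover have "(b \<boxdot> a \<boxdot> a, b \<boxdot> e) \<in> green_H S (\<boxplus>)"
    using green_H_mul_right[OF be' a] Z(1,4) a b by (simp add: mul_assoc)
  ultimately have aH: "(a, b \<boxdot> a) \<in> green_H S (\<boxplus>)"
    using be' green_H_sym green_H_trans by metis
  have "(a \<boxdot> b, b) \<in> green_H S (\<boxplus>)" using green_H_mul_right[OF aH b] bab by simp
  then show ?thesis
    unfolding Hp_class_iff using aH ab green_H_sym green_H_trans by metis
qed

lemma near_ring_Hp_classes_imp_GLCR:
  assumes nr: "\<And>a. a \<in> S \<Longrightarrow> near_ring (Hp_class a) (\<boxplus>) (\<boxdot>)"
  shows GLCR
proof -
  have "\<exists>x\<in>S. a \<boxplus> x \<boxplus> a = a \<and> a \<boxplus> x = x \<boxplus> a \<and> (a \<boxplus> x) \<boxdot> a = a \<boxplus> x" if a: "a \<in> S" for a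
  proof -
    interpret C: near_ring "Hp_class a" "(\<boxplus>)" "(\<boxdot>)" by (rule nr[OF a])
    obtain e where e: "group \<lparr>carrier = Hp_class a, monoid.mult = (\<boxplus>), one = e\<rparr>"
      using C.add_group by blast
    note G = group_recordD[OF e]
    \<comment> \<open>The GLCR witness is the additive inverse within the class; its multiplicative
      condition is then \<open>zero_mul\<close>.\<close>
    obtain x where "x \<in> Hp_class a" "a \<boxplus> x = e" "x \<boxplus> a = e"
      using G(4) Hp_class_self[OF a] by blast
    then show ?thesis
      using G(2) C.zero_mul[OF e] Hp_class_self[OF a] Hp_class_subset by (intro bexI[of _ x]) auto
  qed
  then show ?thesis unfolding GLCR_def additively_completely_regular_def by blast
qed

lemma summand_eq_Hp_class:
  assumes un: "S = \<Union>\<F>" and dj: "disjoint \<F>"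
    and grp: "\<And>N. N \<in> \<F> \<Longrightarrow> \<exists>e. group \<lparr>carrier = N, monoid.mult = (\<boxplus>), one = e\<rparr>"
    and N: "N \<in> \<F>" and a: "a \<in> N"
  shows "Hp_class a = N"
proof
  obtain e where e: "group \<lparr>carrier = N, monoid.mult = (\<boxplus>), one = e\<rparr>" using grp N by blast
  have NS: "N \<subseteq> S" using un N by blast
  note H = subgroup_green_H[OF add_semigroup NS e]
  note G = group_recordD[OF e]
  have ae: "(a, e) \<in> green_H S (\<boxplus>)" by (rule green_H_sym[OF H[OF a]])
  show "N \<subseteq> Hp_class a" using H green_H_trans[OF ae] by (auto simp: Hp_class_iff)
  show "Hp_class a \<subseteq> N"
  proof
    fix c assume c: "c \<in> Hp_class a"
    then have "c \<in> S" using Hp_class_subset by blast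
    then obtain M where M: "M \<in> \<F>" "c \<in> M" using un by blast
    then obtain e' where e': "group \<lparr>carrier = M, monoid.mult = (\<boxplus>), one = e'\<rparr>"
      using grp by blast
    note G' = group_recordD[OF e']
    have "M \<subseteq> S" using un M by blast
    then have "(e', c) \<in> green_H S (\<boxplus>)" using subgroup_green_H[OF add_semigroup _ e' M(2)] by blast
    then have "(e, e') \<in> green_H S (\<boxplus>)"
      using c ae green_H_sym green_H_trans unfolding Hp_class_iff by metis
    then have "e = e'"
      by (rule green_H_idempotent_unique[OF add_semigroup]) (use G(1,2) G'(1,2) in auto)
    \<comment> \<open>The common zero lies in both summands, and disjointness forces them to
      coincide.\<close>
    then have "M = N" using dj M(1) N G(1) G'(1) by (auto simp: disjoint_def)
    then show "c \<in> N" using M(2) by simp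
  qed
qed

end

section \<open>The equivalence of the three characterizations\<close>

theorem theorem2p8:
  fixes S :: "'a set"
    and add :: "'a \<Rightarrow> 'a \<Rightarrow> 'a" (infixl "\<boxplus>" 65)
    and mul :: "'a \<Rightarrow> 'a \<Rightarrow> 'a" (infixl "\<boxdot>" 70)
  assumes "seminearring S (\<boxplus>) (\<boxdot>)"
  shows "((seminearring.GLCR S (\<boxplus>) (\<boxdot>) \<and>
            (\<forall>a\<in>S. \<exists>b\<in>S.
               a \<boxdot> b \<boxdot> a = a \<and>
               b \<boxdot> a \<boxdot> b = b \<and>
               (a \<boxplus> seminearring.star S (\<boxplus>) (\<boxdot>) a) \<boxdot> b \<in> seminearring.Hp_class S (\<boxplus>) (b \<boxdot> a) \<and>
               b \<boxdot> (a \<boxplus> seminearring.star S (\<boxplus>) (\<boxdot>) a) \<in> seminearring.Hp_class S (\<boxplus>) (b \<boxdot> a)))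
          \<longleftrightarrow> (\<forall>C \<in> S // green_H S (\<boxplus>). regular_near_ring C (\<boxplus>) (\<boxdot>)))
       \<and> ((\<forall>C \<in> S // green_H S (\<boxplus>). regular_near_ring C (\<boxplus>) (\<boxdot>))
          \<longleftrightarrow> (\<exists>\<F>. S = \<Union>\<F> \<and> disjoint \<F> \<and> (\<forall>N\<in>\<F>. regular_near_ring N (\<boxplus>) (\<boxdot>))))"
    (is "(?GLCR \<and> ?A \<longleftrightarrow> ?H) \<and> (?H \<longleftrightarrow> ?U)")
proof -
  interpret seminearring S "(\<boxplus>)" "(\<boxdot>)" by (rule assms)
  have "?H" if glcr: ?GLCR and A: ?A
  proof -
    have "regular_near_ring (Hp_class a) (\<boxplus>) (\<boxdot>)" if a: "a \<in> S" for a
    proof (intro regular_near_ring.intro regular_near_ring_axioms.intro)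
      show "near_ring (Hp_class a) (\<boxplus>) (\<boxdot>)" by (rule GLCR_Hp_class_near_ring[OF glcr a])
      fix c assume c: "c \<in> Hp_class a"
      then have cS: "c \<in> S" using Hp_class_subset by blast
      \<comment> \<open>The conditions are applied to \<open>c\<close> rather than \<open>a\<close>,
        since regularity concerns every element of the class; \<open>b\<close> then lies in the
        class of \<open>c\<close>, which is that of \<open>a\<close>.\<close>
      with A obtain b where b: "b \<in> S" "c \<boxdot> b \<boxdot> c = c" "b \<boxdot> c \<boxdot> b = b"
        "(c \<boxplus> star c) \<boxdot> b \<in> Hp_class (b \<boxdot> c)" "b \<boxdot> (c \<boxplus> star c) \<in> Hp_class (b \<boxdot> c)"
        by blast
      have "Hp_class a = Hp_class c" using c Hp_class_eq by (simp add: Hp_class_iff)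
      then have "b \<in> Hp_class a" using GLCR_inverse_in_Hp_class[OF glcr cS b] by simp
      then show "\<exists>b\<in>Hp_class a. c \<boxdot> b \<boxdot> c = c" using b(2) by blast
    qed
    then show ?thesis by (auto simp: quotient_green_H)
  qed
  moreover have "?GLCR \<and> ?A" if H: ?H
  proof
    have reg: "regular_near_ring (Hp_class a) (\<boxplus>) (\<boxdot>)" if "a \<in> S" for a
      using H that by (simp add: quotient_green_H)
    show glcr: ?GLCR
      by (rule near_ring_Hp_classes_imp_GLCR) (rule regular_near_ring.axioms(1)[OF reg])
    show ?A
    proof
      fix a assume a: "a \<in> S"
      interpret C: regular_near_ring "Hp_class a" "(\<boxplus>)" "(\<boxdot>)" by (rule reg[OF a])
      note cl = semigroup_on_closed[OF C.mul_semigroup]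
      have aC: "a \<in> Hp_class a" by (rule Hp_class_self[OF a])
      obtain b where b: "b \<in> Hp_class a" "a \<boxdot> b \<boxdot> a = a" "b \<boxdot> a \<boxdot> b = b"
        using C.reflexive_inverse[OF aC] by blast
      have eC: "a \<boxplus> star a \<in> Hp_class a"
        using GLCR_zero(3)[OF glcr a refl] by (simp add: Hp_class_iff)
      \<comment> \<open>The class is closed under products, so (A3) reduces to two products of
        elements of \<open>Hp_class a\<close>.\<close>
      have "Hp_class (b \<boxdot> a) = Hp_class a"
        using cl[OF b(1) aC] Hp_class_eq by (simp add: Hp_class_iff)
      then show "\<exists>b\<in>S. a \<boxdot> b \<boxdot> a = a \<and> b \<boxdot> a \<boxdot> b = b \<and>
          (a \<boxplus> star a) \<boxdot> b \<in> Hp_class (b \<boxdot> a) \<and> b \<boxdot> (a \<boxplus> star a) \<in> Hp_class (b \<boxdot> a)"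
        using b cl[OF eC b(1)] cl[OF b(1) eC] Hp_class_subset by auto
    qed
  qed
  moreover have ?U if ?H
  proof (intro exI conjI)
    show "S = \<Union>(S // green_H S (\<boxplus>))" by (simp add: Union_quotient[OF equiv_green_H])
    show "disjoint (S // green_H S (\<boxplus>))"
      using quotient_disj[OF equiv_green_H] unfolding disjoint_def by blast
  qed (rule that)
  moreover have ?H if ?U
  proof -
    obtain \<F> where F: "S = \<Union>\<F>" "disjoint \<F>" "\<And>N. N \<in> \<F> \<Longrightarrow> regular_near_ring N (\<boxplus>) (\<boxdot>)"
      using \<open>?U\<close> by blast
    have grp: "\<exists>e. group \<lparr>carrier = N, monoid.mult = (\<boxplus>), one = e\<rparr>" if "N \<in> \<F>" for N
      using near_ring.add_group regular_near_ring.axioms(1) F(3)[OF that] by blast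
    \<comment> \<open>The class equals the summand containing \<open>a\<close>, so it inherits the
      regular near-ring structure directly.\<close>
    have "Hp_class a \<in> \<F>" if "a \<in> S" for a
      using that F(1) summand_eq_Hp_class[OF F(1,2) grp] by (metis UnionE)
    then show ?thesis using F(3) by (auto simp: quotient_green_H)
  qed
  ultimately show ?thesis by blast
qed

end
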